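(* Let $d\ge1$, let $\mu$ be a symmetric nonnegative Radon measure on $\mathbb{R}^d\setminus\{0\}$ with $\int(|z|^2\wedge1)\,\mathrm{d}\mu(z)<+\infty$, and let $u\in L^\infty(\mathbb{R}^d)$. Then $\mathcal{L}^\mu[u]=0$ in $\mathcal{D}'(\mathbb{R}^d)$ if and only if $u$ is $\overline{G(\operatorname{supp}(\mu))}$-periodic (almost everywhere).
   Context: A nonnegative Radon measure on $\mathbb{R}^d\setminus\{0\}$ is a nonnegative Borel measure on $\mathbb{R}^d\setminus\{0\}$ finite on compact subsets of $\mathbb{R}^d\setminus\{0\}$. It is symmetric if $\mu(B)=\mu(-B)$ for all Borel $B$. Its support is $\operatorname{supp}(\mu)=\{z\in\mathbb{R}^d\setminus\{0\}:\mu(B_r(z))>0\ \forall r>0\}$, where $B_r(z)$ is the ball of center $z$ and radius $r$. The symbol $\wedge$ denotes the minimum. The operator $\mathcal{L}^\mu$ is $$\mathcal{L}^\mu[\psi](x)=\mathrm{P.V.}\int_{\mathbb{R}^d\setminus\{0\}}\big(\psi(x+z)-\psi(x)\big)\,\mathrm{d}\mu(z)=\lim_{r\to0^+}\int_{|z|>r}\big(\psi(x+z)-\psi(x)\big)\,\mathrm{d}\mu(z),$$ well defined for $C^2$ functions $\psi$ bounded together with their derivatives up to order two. For $u\in L^\infty(\mathbb{R}^d)$, "$\mathcal{L}^\mu[u]=0$ in $\mathcal{D}'(\mathbb{R}^d)$" means $\int_{\mathbb{R}^d}u(x)\,\mathcal{L}^\mu[\psi](x)\,\mathrm{d}x=0$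 for all $\psi\in C_c^\infty(\mathbb{R}^d)$. For $S\subseteq\mathbb{R}^d$, $G(S)$ is the additive subgroup of $\mathbb{R}^d$ generated by $S$ (the smallest subgroup containing $S$), and $\overline{G(S)}$ is its closure in $\mathbb{R}^d$. A function $u\in L^\infty(\mathbb{R}^d)$ is $S$-periodic if $\int_{\mathbb{R}^d}\big(u(x+s)-u(x)\big)\psi(x)\,\mathrm{d}x=0$ for all $s\in S$ and all $\psi\in C_c^\infty(\mathbb{R}^d)$. *)

theory Defs
  imports "HOL-Analysis.Analysis" "HOL-Computational_Algebra.Group_Closure"
begin

text \<open>
  A measure on the punctured space is a measure whose underlying space is \<^term>\<open>- {0}\<close>, carrying
  the trace of the Borel sigma-algebra.  A subset of the punctured space is compact in the subspace
  topology iff it is compact in the ambient space.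
\<close>

definition radon_measure_punctured :: "'a::euclidean_space measure \<Rightarrow> bool" where
  "radon_measure_punctured M \<longleftrightarrow>
     sets M = sets (restrict_space borel (- {0})) \<and>
     (\<forall>K. compact K \<and> K \<subseteq> - {0} \<longrightarrow> emeasure M K < \<infinity>)"

definition symmetric_measure :: "'a::euclidean_space measure \<Rightarrow> bool" where
  "symmetric_measure M \<longleftrightarrow> (\<forall>B\<in>sets M. emeasure M B = emeasure M (uminus ` B))"

text \<open>
  Balls have to be intersected with the underlying space: a ball containing the origin is not in
  \<^term>\<open>sets M\<close>, and \<^const>\<open>emeasure\<close> vanishes outside \<^term>\<open>sets M\<close>.
\<close>

definition measure_supp :: "'a::euclidean_space measure \<Rightarrow> 'a set" where
  "measure_supp M = {z. z \<noteq> 0 \<and> (\<forall>r>0. emeasure M (ball z r - {0}) > 0)}"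

primrec Ck_fun :: "nat \<Rightarrow> ('a::euclidean_space \<Rightarrow> real) \<Rightarrow> bool" where
  "Ck_fun 0 f \<longleftrightarrow> continuous_on UNIV f"
| "Ck_fun (Suc k) f \<longleftrightarrow>
     (\<forall>x. f differentiable (at x)) \<and> (\<forall>v. Ck_fun k (\<lambda>x. frechet_derivative f (at x) v))"

definition test_function :: "('a::euclidean_space \<Rightarrow> real) \<Rightarrow> bool" where
  "test_function \<psi> \<longleftrightarrow> (\<forall>k. Ck_fun k \<psi>) \<and> compact (closure {x. \<psi> x \<noteq> 0})"

definition levy_operator ::
  "'a::euclidean_space measure \<Rightarrow> ('a \<Rightarrow> real) \<Rightarrow> 'a \<Rightarrow> real" where
  "levy_operator M \<psi> x =
     Lim (at_right 0) (\<lambda>r::real. LINT z:{z. norm z > r}|M. \<psi> (x + z) - \<psi> x)"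

definition L_infinity :: "('a::euclidean_space \<Rightarrow> real) \<Rightarrow> bool" where
  "L_infinity u \<longleftrightarrow>
     u \<in> borel_measurable lebesgue \<and> (\<exists>C. AE x in lebesgue. \<bar>u x\<bar> \<le> C)"

definition levy_harmonic_distr ::
  "'a::euclidean_space measure \<Rightarrow> ('a \<Rightarrow> real) \<Rightarrow> bool" where
  "levy_harmonic_distr M u \<longleftrightarrow>
     (\<forall>\<psi>. test_function \<psi> \<longrightarrow> (LINT x|lebesgue. u x * levy_operator M \<psi> x) = 0)"

definition periodic_ae :: "'a::euclidean_space set \<Rightarrow> ('a \<Rightarrow> real) \<Rightarrow> bool" where
  "periodic_ae S u \<longleftrightarrow>
     (\<forall>s\<in>S. \<forall>\<psi>. test_function \<psi> \<longrightarrow> (LINT x|lebesgue. (u (x + s) - u x) * \<psi> x) = 0)"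

end

theory Submission
  imports Defs
begin

text \<open>
  Pairing \<open>u\<close> with the translates of a test function \<open>\<psi>\<close> gives the function
  \<open>V y = \<integral> u (x + y) \<psi> x dx\<close>, which is bounded, uniformly continuous and has second differences
  \<open>V (y + z) + V (y - z) - 2 V y\<close> dominated by \<open>min |z|\<^sup>2 1\<close>. By symmetry of the measure and Fubini,
  \<open>u\<close> is harmonic iff for every \<open>\<psi>\<close> the second differences of \<open>V\<close> at every point integrate to 0
  in \<open>z\<close>, and \<open>u\<close> is \<open>s\<close>-periodic iff \<open>V s = V 0\<close> for every \<open>\<psi>\<close>. If \<open>V\<close> is periodic with respect
  to the support, its second differences at 0 vanish almost everywhere. Conversely, for \<open>s\<close> in the support
  a quantitative maximum principle applied to \<open>V (y + s) - V y\<close> avoids any compactness argument: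
  near-maximality at \<open>y\<close> propagates to \<open>y + s\<close>, hence to \<open>y + j s\<close> for all \<open>j < n\<close>, and
  boundedness of \<open>V\<close> forces the supremum to be nonpositive. Periods of the continuous \<open>V\<close>
  form a closed subgroup.
\<close>

section \<open>Test functions\<close>

text \<open>An equivalence, so that it can rewrite under the choice operator that defines
  \<open>frechet_derivative\<close>: the derivative of a translate is then literally the translated
  derivative.\<close>

lemma has_derivative_shift:
  fixes f :: "'a::real_normed_vector \<Rightarrow> 'b::real_normed_vector"
  shows "((\<lambda>x. f (x + a)) has_derivative f') (at x) \<longleftrightarrow> (f has_derivative f') (at (x + a))"
proof
  assume "(f has_derivative f') (at (x + a))"
  then have "(f has_derivative f') (at (x + a) within range (\<lambda>x. x + a))"
    by (rule has_derivative_at_withinI)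
  moreover have "((\<lambda>x. x + a) has_derivative (\<lambda>x. x)) (at x)"
    by (auto intro!: derivative_eq_intros)
  ultimately show "((\<lambda>x. f (x + a)) has_derivative f') (at x)"
    by (rule has_derivative_in_compose[of "\<lambda>x. x + a" "\<lambda>x. x" x UNIV f f', rotated])
next
  assume *: "((\<lambda>x. f (x + a)) has_derivative f') (at x)"
  have "((\<lambda>x. x - a) has_derivative (\<lambda>x. x)) (at (x + a))"
    by (auto intro!: derivative_eq_intros)
  from has_derivative_compose[OF this, of "\<lambda>x. f (x + a)" f'] *
  show "(f has_derivative f') (at (x + a))" by simp
qed

lemma Ck_fun_shift:
  "Ck_fun k f \<Longrightarrow> Ck_fun k (\<lambda>x. f (x + a))"
proof (induction k arbitrary: f)
  case 0
  then show ?case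
    by (auto intro!: continuous_intros continuous_on_compose2[of UNIV f])
next
  case (Suc k)
  then show ?case
    by (auto simp: differentiable_def has_derivative_shift frechet_derivative_def)
qed

lemma test_function_zero_outside:
  assumes "test_function \<psi>"
  obtains R where "R > 0" "\<And>x. norm x > R \<Longrightarrow> \<psi> x = 0"
proof -
  have "bounded (closure {x. \<psi> x \<noteq> 0})"
    using assms compact_imp_bounded unfolding test_function_def by blast
  then obtain R where "R > 0" "\<And>x. x \<in> closure {x. \<psi> x \<noteq> 0} \<Longrightarrow> norm x \<le> R"
    unfolding bounded_pos by blast
  then show thesis
    using closure_subset[of "{x. \<psi> x \<noteq> 0}"] that[of R] by fastforce
qed

lemma test_function_shift:
  assumes "test_function \<psi>"
  shows "test_function (\<lambda>x. \<psi> (x + a))"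
proof -
  obtain R where R: "\<And>x. norm x > R \<Longrightarrow> \<psi> x = 0"
    using test_function_zero_outside[OF assms] by blast
  have "{x. \<psi> (x + a) \<noteq> 0} \<subseteq> cball (- a) R"
    using R by (force simp: dist_norm norm_minus_commute add.commute)
  then have "bounded {x. \<psi> (x + a) \<noteq> 0}"
    by (rule bounded_subset[OF bounded_cball])
  then show ?thesis
    using assms Ck_fun_shift by (auto simp: test_function_def)
qed

lemma Ck_fun_Suc_imp:
  assumes "Ck_fun (Suc k) f"
  shows "(f has_derivative frechet_derivative f (at x)) (at x)"
    and "Ck_fun k (\<lambda>x. frechet_derivative f (at x) v)"
  using assms frechet_derivative_works[of f "at x"] by auto

text \<open>The exterior of a ball is open, so \<open>f\<close> is locally zero there. Keeping the
  same \<open>R\<close> lets directional derivatives satisfy the vanishing hypothesis again.\<close>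

lemma frechet_derivative_zero_outside:
  fixes f :: "'a::euclidean_space \<Rightarrow> real"
  assumes "\<And>x. norm x > R \<Longrightarrow> f x = 0" and "norm x > R"
  shows "frechet_derivative f (at x) v = 0"
proof -
  have "open {x::'a. norm x > R}"
    by (intro open_Collect_less continuous_intros)
  then have "(f has_derivative (\<lambda>_. 0)) (at x)"
    using assms
    by (intro has_derivative_transform_within_open[of "\<lambda>_. 0" "\<lambda>_. 0" x UNIV "{x. norm x > R}" f])
       auto
  then show ?thesis
    by (metis frechet_derivative_at)
qed

lemma bounded_of_zero_outside:
  fixes f :: "'a::euclidean_space \<Rightarrow> real"
  assumes "continuous_on UNIV f" and "\<And>x. norm x > R \<Longrightarrow> f x = 0"
  obtains K where "K \<ge> 0" "\<And>x. \<bar>f x\<bar> \<le> K"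
proof -
  have "bounded (f ` cball 0 R)"
    by (intro compact_imp_bounded compact_continuous_image)
       (auto intro: continuous_on_subset[OF assms(1)])
  then obtain K where K: "K > 0" "\<And>x. norm x \<le> R \<Longrightarrow> \<bar>f x\<bar> \<le> K"
    unfolding bounded_pos by auto
  have "\<bar>f x\<bar> \<le> K" for x
    using K assms(2)[of x] by (cases "norm x \<le> R") auto
  with K(1) show thesis by (intro that[of K]) auto
qed

text \<open>\<open>Ck_fun\<close> controls a derivative one direction at a time; this turns bounds
  on the finitely many basis directions into an operator norm bound.\<close>

lemma linear_functional_bound:
  fixes g :: "'a::euclidean_space \<Rightarrow> real"
  assumes "linear g" and "\<And>b. b \<in> Basis \<Longrightarrow> \<bar>g b\<bar> \<le> K"
  shows "\<bar>g v\<bar> \<le> real DIM('a) * K * norm v"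
proof -
  have "g v = (\<Sum>b\<in>Basis. (v \<bullet> b) * g b)"
    by (subst (1) euclidean_representation[symmetric, of v])
       (simp add: linear_sum[OF assms(1)] linear_cmul[OF assms(1)])
  also have "\<bar>\<dots>\<bar> \<le> (\<Sum>b\<in>Basis. \<bar>(v \<bullet> b) * g b\<bar>)" by (rule sum_abs)
  also have "\<dots> \<le> (\<Sum>b\<in>(Basis::'a set). norm v * K)"
    using assms(2) by (intro sum_mono) (auto simp: abs_mult intro!: mult_mono Basis_le_norm)
  finally show ?thesis by (simp add: ac_simps)
qed

text \<open>The directional derivatives are continuous and vanish outside a ball, hence are bounded.
  Bounds in the basis directions then control the operator norm, and the mean value inequality
  applies.\<close>

lemma C1_zero_outside_imp_lipschitz:
  fixes f :: "'a::euclidean_space \<Rightarrow> real"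
  assumes f: "Ck_fun (Suc 0) f" and R: "\<And>x. norm x > R \<Longrightarrow> f x = 0"
  obtains L where "L \<ge> 0" "\<And>x y. \<bar>f x - f y\<bar> \<le> L * norm (x - y)"
proof -
  let ?D = "\<lambda>x. frechet_derivative f (at x)"
  note D = Ck_fun_Suc_imp(1)[OF f]
  have zero: "?D x b = 0" if "norm x > R" for x b
    using R that by (rule frechet_derivative_zero_outside)
  have "continuous_on UNIV (\<lambda>x. ?D x b)" for b
    using Ck_fun_Suc_imp(2)[OF f] by simp
  from bounded_of_zero_outside[OF this zero]
  have "\<exists>K. K \<ge> 0 \<and> (\<forall>x. \<bar>?D x b\<bar> \<le> K)" for b by blast
  then obtain K where K: "\<And>b. K b \<ge> 0" "\<And>b x. \<bar>?D x b\<bar> \<le> K b" by metis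
  define L where "L = real DIM('a) * (\<Sum>b\<in>Basis. K b)"
  have L: "L \<ge> 0" using K(1) by (auto simp: L_def intro!: mult_nonneg_nonneg sum_nonneg)
  have "\<bar>?D x v\<bar> \<le> L * norm v" for x v
    unfolding L_def
  proof (rule linear_functional_bound)
    show "linear (?D x)" using D has_derivative_linear by blast
    show "\<bar>?D x b\<bar> \<le> (\<Sum>b\<in>Basis. K b)" if "b \<in> Basis" for b
      using K(2)[of x b] member_le_sum[OF that, of K] K(1) by fastforce
  qed
  then have "onorm (?D x) \<le> L" for x
    by (intro onorm_bound L) auto
  then have "norm (f x - f y) \<le> L * norm (x - y)" for x y
    using D by (intro differentiable_bound[of UNIV f ?D]) auto
  with L that show thesis by auto
qed

text \<open>Pairing \<open>z\<close> with \<open>- z\<close> cancels the first-order term, leaving a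
  quantity quadratic in \<open>z\<close>, as the integrability condition on the measure
  demands.\<close>

definition second_diff :: "('a::real_vector \<Rightarrow> real) \<Rightarrow> 'a \<Rightarrow> 'a \<Rightarrow> real" where
  "second_diff f x z = f (x + z) + f (x - z) - 2 * f x"

text \<open>The directional derivatives are themselves C1 and vanish outside a ball, so the
  derivative is Lipschitz in the base point.\<close>

lemma C2_zero_outside_imp_second_diff_bound:
  fixes f :: "'a::euclidean_space \<Rightarrow> real"
  assumes f: "Ck_fun (Suc (Suc 0)) f" and R: "\<And>x. norm x > R \<Longrightarrow> f x = 0"
  obtains B where "B \<ge> 0" "\<And>x z. \<bar>second_diff f x z\<bar> \<le> B * (norm z)\<^sup>2"
proof -
  let ?D = "\<lambda>x. frechet_derivative f (at x)"
  note D = Ck_fun_Suc_imp(1)[OF f]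
  have zero: "?D x b = 0" if "norm x > R" for x b
    using R that by (rule frechet_derivative_zero_outside)
  have "\<exists>K. K \<ge> 0 \<and> (\<forall>x y. \<bar>?D x b - ?D y b\<bar> \<le> K * norm (x - y))" for b
    by (rule C1_zero_outside_imp_lipschitz[OF Ck_fun_Suc_imp(2)[OF f, of b] zero]) auto
  then obtain K where K: "\<And>b. K b \<ge> 0" "\<And>b x y. \<bar>?D x b - ?D y b\<bar> \<le> K b * norm (x - y)"
    by metis
  define L where "L = real DIM('a) * (\<Sum>b\<in>Basis. K b)"
  have L: "L \<ge> 0" using K(1) by (auto simp: L_def intro!: mult_nonneg_nonneg sum_nonneg)
  have Dlip: "\<bar>?D x v - ?D y v\<bar> \<le> L * norm (x - y) * norm v" for x y v
  proof -
    have "\<bar>(\<lambda>v. ?D x v - ?D y v) v\<bar> \<le> real DIM('a) * ((\<Sum>b\<in>Basis. K b) * norm (x - y)) * norm v"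
    proof (rule linear_functional_bound)
      show "linear (\<lambda>v. ?D x v - ?D y v)"
        using D has_derivative_linear linear_compose_sub by blast
      fix b :: 'a assume b: "b \<in> Basis"
      have "K b * norm (x - y) \<le> (\<Sum>b\<in>Basis. K b) * norm (x - y)"
        using member_le_sum[OF b, of K] K(1) by (intro mult_right_mono) auto
      then show "\<bar>?D x b - ?D y b\<bar> \<le> (\<Sum>b\<in>Basis. K b) * norm (x - y)"
        using K(2)[of x b y] by linarith
    qed
    then show ?thesis by (simp add: L_def ac_simps)
  qed
  have "\<bar>second_diff f x z\<bar> \<le> 2 * L * (norm z)\<^sup>2" for x z
  proof -
    \<comment> \<open>\<open>g 1 - g 0\<close> is the second difference, while \<open>g' t\<close>
      compares derivatives at points at distance \<open>2 * t * norm z\<close>; a single use of the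
      mean value theorem therefore yields the quadratic bound.\<close>
    define g where "g t = f (x + t *\<^sub>R z) + f (x - t *\<^sub>R z)" for t :: real
    define g' where "g' t = ?D (x + t *\<^sub>R z) z - ?D (x - t *\<^sub>R z) z" for t :: real
    have g': "(g has_real_derivative g' t) (at t)" for t
    proof -
      have 1: "((\<lambda>t. f (x + t *\<^sub>R z)) has_derivative (\<lambda>h. ?D (x + t *\<^sub>R z) (h *\<^sub>R z))) (at t)"
        by (rule has_derivative_compose[OF _ D]) (auto intro!: derivative_eq_intros)
      have 2: "((\<lambda>t. f (x - t *\<^sub>R z)) has_derivative (\<lambda>h. ?D (x - t *\<^sub>R z) (- (h *\<^sub>R z)))) (at t)"
        by (rule has_derivative_compose[OF _ D]) (auto intro!: derivative_eq_intros)
      have lin: "linear (?D y)" for y using D has_derivative_linear by blast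
      show ?thesis
        unfolding has_field_derivative_def g_def
        by (rule has_derivative_eq_rhs[OF has_derivative_add[OF 1 2]])
           (auto simp: g'_def linear_cmul[OF lin] linear_neg[OF lin] algebra_simps)
    qed
    obtain t where t: "0 < t" "t < 1" "g 1 - g 0 = (1 - 0) * g' t"
      using MVT2[of 0 1 g g'] g' by auto
    have "\<bar>g' t\<bar> \<le> L * norm ((x + t *\<^sub>R z) - (x - t *\<^sub>R z)) * norm z"
      unfolding g'_def by (rule Dlip)
    also have "(x + t *\<^sub>R z) - (x - t *\<^sub>R z) = (2 * t) *\<^sub>R z"
      by (simp add: algebra_simps flip: scaleR_add_left)
    also have "L * norm ((2 * t) *\<^sub>R z) * norm z = (2 * L * (norm z)\<^sup>2) * t"
      using t by (simp add: power2_eq_square)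
    also have "\<dots> \<le> (2 * L * (norm z)\<^sup>2) * 1"
      using t L by (intro mult_left_mono) auto
    finally show ?thesis using t by (simp add: g_def second_diff_def)
  qed
  with L that[of "2 * L"] show thesis by simp
qed

section \<open>Bounds on integrals and translation invariance of Lebesgue measure\<close>

lemma L1_zero_outside:
  fixes h :: "'a::euclidean_space \<Rightarrow> real"
  assumes [measurable]: "h \<in> borel_measurable borel"
    and "\<And>x. \<bar>h x\<bar> \<le> B" and "\<And>x. norm x > R \<Longrightarrow> h x = 0"
  shows "integrable lborel h"
    and "(LINT x|lborel. \<bar>h x\<bar>) \<le> B * measure lborel (cball (0::'a) R)"
proof -
  have le: "\<bar>h x\<bar> \<le> B * indicator (cball 0 R) x" for x
    using assms(2)[of x] assms(3)[of x] by (auto simp: indicator_def)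
  have int: "integrable lborel (\<lambda>x. B * indicator (cball (0::'a) R) x)"
    using emeasure_bounded_finite[of "cball (0::'a) R"]
    by (intro integrable_mult_right integrable_real_indicator) auto
  show h: "integrable lborel h"
    by (rule Bochner_Integration.integrable_bound[OF int])
       (use le in \<open>auto intro: order_trans[OF _ abs_ge_self]\<close>)
  have "(LINT x|lborel. \<bar>h x\<bar>) \<le> (LINT x|lborel. B * indicator (cball (0::'a) R) x)"
    using le h int by (intro integral_mono) auto
  then show "(LINT x|lborel. \<bar>h x\<bar>) \<le> B * measure lborel (cball (0::'a) R)" by simp
qed

lemma test_function_imp:
  assumes "test_function \<psi>"
  shows "continuous_on UNIV \<psi>" "\<psi> \<in> borel_measurable borel" "integrable lborel \<psi>"
    and "\<exists>K\<ge>0. \<forall>x. \<bar>\<psi> x\<bar> \<le> K"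
proof -
  show c: "continuous_on UNIV \<psi>" using assms unfolding test_function_def by (metis Ck_fun.simps(1))
  then show m: "\<psi> \<in> borel_measurable borel" by (rule borel_measurable_continuous_onI)
  obtain R where R: "\<And>x. norm x > R \<Longrightarrow> \<psi> x = 0"
    using test_function_zero_outside[OF assms] by blast
  obtain K where K: "K \<ge> 0" "\<And>x. \<bar>\<psi> x\<bar> \<le> K"
    using bounded_of_zero_outside[OF c R] by blast
  show "integrable lborel \<psi>" using L1_zero_outside(1)[OF m K(2) R] .
  show "\<exists>K\<ge>0. \<forall>x. \<bar>\<psi> x\<bar> \<le> K" using K by blast
qed

lemma lborel_integral_shift:
  fixes f :: "'a::euclidean_space \<Rightarrow> real"
  assumes [measurable]: "f \<in> borel_measurable borel"
  shows "(LINT x|lborel. f (x + a)) = (LINT x|lborel. f x)"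
proof -
  have "(LINT x|lborel. f x) = (LINT x|distr lborel borel ((+) a). f x)"
    by (simp add: lborel_distr_plus)
  also have "\<dots> = (LINT x|lborel. f (a + x))"
    by (subst integral_distr) auto
  finally show ?thesis by (simp add: add.commute)
qed

lemma lborel_integrable_shift:
  fixes f :: "'a::euclidean_space \<Rightarrow> real"
  assumes "integrable lborel f"
  shows "integrable lborel (\<lambda>x. f (x + a))"
proof -
  have "integrable (distr lborel borel ((+) a)) f"
    using assms by (simp add: lborel_distr_plus)
  then show ?thesis
    by (subst (asm) integrable_distr_eq) (use assms in \<open>auto simp: add.commute\<close>)
qed

lemma test_function_L1_modulus:
  assumes "test_function \<psi>" "e > 0"
  obtains d where "d > 0"
    "\<And>z. norm z < d \<Longrightarrow> (LINT x|lborel. \<bar>\<psi> (x + z) - \<psi> x\<bar>) < e"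
proof -
  obtain R where R: "R > 0" "\<And>x. norm x > R \<Longrightarrow> \<psi> x = 0"
    using test_function_zero_outside[OF assms(1)] by blast
  have "Ck_fun (Suc 0) \<psi>" using assms(1) unfolding test_function_def by blast
  then obtain L where L: "L \<ge> 0" "\<And>x y. \<bar>\<psi> x - \<psi> y\<bar> \<le> L * norm (x - y)"
    using C1_zero_outside_imp_lipschitz R(2) by metis
  define V where "V = measure lborel (cball (0::'a) (R + 1))"
  have V: "V \<ge> 0" by (simp add: V_def)
  have [measurable]: "\<psi> \<in> borel_measurable borel" using test_function_imp assms by blast
  show thesis
  \<comment> \<open>The cap 1 keeps the increment supported in the ball of radius
    \<open>R + 1\<close>; the summand 1 in the denominator avoids division by zero.\<close>
  proof (rule that[of "min 1 (e / (L * V + 1))"])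
    show "0 < min 1 (e / (L * V + 1))" using assms(2) L V by (simp add: add_nonneg_pos)
    fix z :: 'a assume z: "norm z < min 1 (e / (L * V + 1))"
    have "(LINT x|lborel. \<bar>\<psi> (x + z) - \<psi> x\<bar>) \<le> (L * norm z) * V"
      unfolding V_def
    proof (rule L1_zero_outside)
      show "\<bar>\<psi> (x + z) - \<psi> x\<bar> \<le> L * norm z" for x using L(2)[of "x + z" x] by simp
      show "\<psi> (x + z) - \<psi> x = 0" if "norm x > R + 1" for x
        using that z R norm_triangle_ineq4[of "x + z" z] by simp
    qed measurable
    also have "\<dots> = norm z * (L * V)" by simp
    also have "\<dots> \<le> norm z * (L * V + 1)" by (simp add: mult_left_mono)
    also have "\<dots> < e"
      using z L V by (simp add: pos_less_divide_eq add_nonneg_pos)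
    finally show "(LINT x|lborel. \<bar>\<psi> (x + z) - \<psi> x\<bar>) < e" .
  qed
qed

text \<open>The quadratic bound serves when \<open>norm z\<close> is at most 1. Beyond that, the
  values of \<psi> enter with total weight 4, which accounts for \<open>4 * K\<close>.\<close>

lemma test_function_second_diff_bound:
  assumes "test_function \<psi>"
  obtains C where "C \<ge> 0"
    "\<And>x z. \<bar>second_diff \<psi> x z\<bar> \<le> C * min ((norm z)\<^sup>2) 1"
proof -
  obtain R where R: "R > 0" "\<And>x. norm x > R \<Longrightarrow> \<psi> x = 0"
    using test_function_zero_outside[OF assms] by blast
  have "Ck_fun (Suc (Suc 0)) \<psi>" using assms unfolding test_function_def by blast
  then obtain B where B: "B \<ge> 0" "\<And>x z. \<bar>second_diff \<psi> x z\<bar> \<le> B * (norm z)\<^sup>2"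
    using C2_zero_outside_imp_second_diff_bound R(2) by metis
  obtain K where K: "K \<ge> 0" "\<And>x. \<bar>\<psi> x\<bar> \<le> K" using test_function_imp(4)[OF assms] by blast
  have "\<bar>second_diff \<psi> x z\<bar> \<le> (B + 4 * K) * min ((norm z)\<^sup>2) 1" for x z
  proof (cases "(norm z)\<^sup>2 \<le> 1")
    case True
    have "B * (norm z)\<^sup>2 \<le> (B + 4 * K) * (norm z)\<^sup>2" using K by (intro mult_right_mono) auto
    with True B(2)[of x z] show ?thesis by simp
  next
    case False
    then show ?thesis
      using K(2)[of "x + z"] K(2)[of "x - z"] K(2)[of x] B(1) by (simp add: second_diff_def)
  qed
  then show thesis using that[of "B + 4 * K"] B K by simp
qed

text \<open>An integrated bound is required because the second difference will be paired with a
  function that is merely bounded. For small \<open>z\<close> the support stays in a fixed ball; for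
  large \<open>z\<close> translation invariance gives \<open>4 * I\<close>.\<close>

lemma test_function_second_diff_L1_bound:
  assumes "test_function \<psi>"
  obtains C where "\<And>z. integrable lborel (\<lambda>x. second_diff \<psi> x z)"
    "\<And>z. (LINT x|lborel. \<bar>second_diff \<psi> x z\<bar>) \<le> C * min ((norm z)\<^sup>2) 1"
proof -
  obtain R where R: "R > 0" "\<And>x. norm x > R \<Longrightarrow> \<psi> x = 0"
    using test_function_zero_outside[OF assms] by blast
  obtain B where B: "B \<ge> 0" "\<And>x z. \<bar>second_diff \<psi> x z\<bar> \<le> B * min ((norm z)\<^sup>2) 1"
    using test_function_second_diff_bound[OF assms] by blast
  note [measurable] = test_function_imp(2)[OF assms]
  note int = test_function_imp(3)[OF assms]
  define V where "V = measure lborel (cball (0::'a) (R + 1))"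
  define I where "I = (LINT x|lborel. \<bar>\<psi> x\<bar>)"
  have nn: "V \<ge> 0" "I \<ge> 0" by (auto simp: V_def I_def)
  have int': "integrable lborel (\<lambda>x. \<psi> (x + z))" "integrable lborel (\<lambda>x. \<psi> (x - z))" for z
    using lborel_integrable_shift[OF int, of z] lborel_integrable_shift[OF int, of "- z"] by auto
  have sd: "integrable lborel (\<lambda>x. second_diff \<psi> x z)" for z
    unfolding second_diff_def using int int' by auto
  have "(LINT x|lborel. \<bar>second_diff \<psi> x z\<bar>) \<le> (B * V + 4 * I) * min ((norm z)\<^sup>2) 1" for z
  proof (cases "norm z \<le> 1")
    case True
    then have z: "(norm z)\<^sup>2 \<le> 1" by (simp add: power_le_one)
    have "(LINT x|lborel. \<bar>second_diff \<psi> x z\<bar>) \<le> (B * (norm z)\<^sup>2) * V"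
      unfolding V_def
    proof (rule L1_zero_outside)
      show "\<bar>second_diff \<psi> x z\<bar> \<le> B * (norm z)\<^sup>2" for x using B(2)[of x z] z by simp
      show "second_diff \<psi> x z = 0" if "norm x > R + 1" for x
        using that True R norm_triangle_ineq4[of "x + z" z] norm_triangle_ineq[of "x - z" z]
        by (simp add: second_diff_def)
    qed (unfold second_diff_def, measurable)
    also have "\<dots> = B * V * (norm z)\<^sup>2" by simp
    also have "\<dots> \<le> (B * V + 4 * I) * (norm z)\<^sup>2"
      using nn by (intro mult_right_mono) auto
    finally show ?thesis using z by simp
  next
    case False
    then have z: "(norm z)\<^sup>2 \<ge> 1" by simp
    have "(LINT x|lborel. \<bar>second_diff \<psi> x z\<bar>)
        \<le> (LINT x|lborel. \<bar>\<psi> (x + z)\<bar> + \<bar>\<psi> (x + - z)\<bar> + 2 * \<bar>\<psi> x\<bar>)"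
      using int int' sd by (intro integral_mono) (auto simp: second_diff_def)
    also have "\<dots> = (LINT x|lborel. \<bar>\<psi> (x + z)\<bar>) + (LINT x|lborel. \<bar>\<psi> (x + - z)\<bar>) + 2 * I"
      using int int' by (simp add: I_def)
    also have "\<dots> = 4 * I"
      using lborel_integral_shift[of "\<lambda>x. \<bar>\<psi> x\<bar>"] by (simp add: I_def del: add_uminus_conv_diff)
    also have "\<dots> \<le> B * V + 4 * I" using B nn by simp
    finally show ?thesis using z by simp
  qed
  then show thesis using that[of "B * V + 4 * I"] sd by simp
qed

section \<open>Maximum principle\<close>

lemma second_diff_measurable [measurable]:
  fixes f :: "'a::euclidean_space \<Rightarrow> real"
  assumes [measurable]: "f \<in> borel_measurable borel"
  shows "second_diff f x \<in> borel_measurable borel"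
  unfolding second_diff_def[abs_def] by measurable

section \<open>Integrability, exhaustion and reflection for the measure\<close>

locale levy_measure =
  fixes \<mu> :: "'a::euclidean_space measure"
  assumes radon: "radon_measure_punctured \<mu>"
    and symmetric: "symmetric_measure \<mu>"
    and finite_levy: "(\<integral>\<^sup>+ z. ennreal (min ((norm z)\<^sup>2) 1) \<partial>\<mu>) < \<infinity>"
begin

lemma sets_levy: "sets \<mu> = sets (restrict_space borel (- {0}))"
  using radon by (simp add: radon_measure_punctured_def)

lemma space_levy: "space \<mu> = - {0}"
  using sets_eq_imp_space_eq[OF sets_levy] by (simp add: space_restrict_space)

lemma measurable_levy: "f \<in> borel \<rightarrow>\<^sub>M N \<Longrightarrow> f \<in> \<mu> \<rightarrow>\<^sub>M N"
  using measurable_restrict_space1[of f borel N "- {0}"] measurable_cong_sets[OF sets_levy refl]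
  by blast

lemma in_sets_levy: "A \<in> sets borel \<Longrightarrow> 0 \<notin> A \<Longrightarrow> A \<in> sets \<mu>"
  by (auto simp: sets_levy sets_restrict_space image_iff intro!: bexI[of _ A])

lemma integrable_levy_weight: "integrable \<mu> (\<lambda>z. min ((norm z)\<^sup>2) 1)"
  using finite_levy by (intro integrableI_nonneg measurable_levy) auto

lemma integrable_of_levy_bound:
  assumes "f \<in> borel_measurable borel" "\<And>z. \<bar>f z\<bar> \<le> C * min ((norm z)\<^sup>2) 1"
  shows "integrable \<mu> f"
  by (rule Bochner_Integration.integrable_bound[OF integrable_mult_right[OF integrable_levy_weight, of C]])
     (use assms in \<open>auto intro!: measurable_levy AE_I2 intro: order_trans[OF _ abs_ge_self]\<close>)

text \<open>Markov's inequality: the integrable weight is at least \<open>min (r\<^sup>2) 1\<close>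
  on this set.\<close>

lemma emeasure_levy_away:
  assumes "r > 0"
  shows "emeasure \<mu> {z. norm z > r} < \<infinity>"
proof -
  define c where "c = min (r\<^sup>2) 1"
  have c: "c > 0" using assms by (simp add: c_def)
  have A: "{z. norm z > r} \<in> sets \<mu>"
    using assms by (intro in_sets_levy borel_open open_Collect_less continuous_intros) auto
  have "ennreal c * emeasure \<mu> {z. norm z > r}
      = (\<integral>\<^sup>+ z. ennreal c * indicator {z. norm z > r} z \<partial>\<mu>)"
    using A by (simp add: nn_integral_cmult_indicator)
  also have "\<dots> \<le> (\<integral>\<^sup>+ z. ennreal (min ((norm z)\<^sup>2) 1) \<partial>\<mu>)"
  proof (rule nn_integral_mono)
    fix z
    have "c \<le> min ((norm z)\<^sup>2) 1" if "norm z > r"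
      using that assms power_mono[of r "norm z" 2] unfolding c_def by (intro min.mono) auto
    then show "ennreal c * indicator {z. norm z > r} z \<le> ennreal (min ((norm z)\<^sup>2) 1)"
      by (auto simp: indicator_def intro: ennreal_leI)
  qed
  also have "\<dots> < \<infinity>" by (rule finite_levy)
  finally show ?thesis
    using c by (auto simp: ennreal_mult_less_top)
qed

text \<open>The complements of shrinking balls around the origin exhaust the punctured space.
  Fubini's theorem will rely on this.\<close>

lemma sigma_finite_levy: "sigma_finite_measure \<mu>"
proof
  let ?A = "\<lambda>n. {z::'a. norm z > 1 / real (Suc n)}"
  have "?A n \<in> sets \<mu>" for n
    by (intro in_sets_levy borel_open open_Collect_less continuous_intros)
       (simp add: less_le_not_le)
  moreover have "z \<in> (\<Union>n. ?A n)" if "z \<noteq> 0" for z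
    using reals_Archimedean[of "norm z"] that by (auto simp: inverse_eq_divide)
  moreover have "0 \<notin> (\<Union>n. ?A n)" by (auto simp: less_le_not_le)
  ultimately have "\<Union>(range ?A) = space \<mu>" unfolding space_levy by blast
  then show "\<exists>A. countable A \<and> A \<subseteq> sets \<mu> \<and> \<Union>A = space \<mu> \<and> (\<forall>a\<in>A. emeasure \<mu> a \<noteq> \<infinity>)"
    using \<open>\<And>n. ?A n \<in> sets \<mu>\<close> emeasure_levy_away[of "1 / real (Suc _)"]
    by (intro exI[of _ "range ?A"]) (auto simp: less_top simp del: of_nat_Suc)
qed

text \<open>Symmetry recast as invariance of the image measure, the form that a change of variables
  uses.\<close>

lemma distr_uminus_levy: "distr \<mu> \<mu> uminus = \<mu>"
proof (rule measure_eqI)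
  have [measurable]: "uminus \<in> \<mu> \<rightarrow>\<^sub>M \<mu>"
    unfolding measurable_cong_sets[OF refl sets_levy]
    by (intro measurable_restrict_space2 measurable_levy) (auto simp: space_levy)
  fix B assume "B \<in> sets (distr \<mu> \<mu> uminus)"
  then have B: "B \<in> sets \<mu>" by simp
  then have "B \<subseteq> - {0}" using sets.sets_into_space space_levy by metis
  then have "uminus -` B \<inter> space \<mu> = uminus ` B"
    by (auto simp: space_levy image_iff) (metis minus_minus)
  then show "emeasure (distr \<mu> \<mu> uminus) B = emeasure \<mu> B"
    using symmetric B by (simp add: emeasure_distr symmetric_measure_def)
qed simp

lemma integral_reflect_levy:
  fixes f :: "'a \<Rightarrow> real"
  assumes "f \<in> borel_measurable borel"
  shows "(LINT z|\<mu>. f (- z)) = (LINT z|\<mu>. f z)"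
proof -
  have m: "uminus \<in> \<mu> \<rightarrow>\<^sub>M \<mu>"
    unfolding measurable_cong_sets[OF refl sets_levy]
    by (intro measurable_restrict_space2 measurable_levy) (auto simp: space_levy)
  have "(LINT z|\<mu>. f z) = (LINT z|distr \<mu> \<mu> uminus. f z)" by (simp add: distr_uminus_levy)
  also have "\<dots> = (LINT z|\<mu>. f (- z))"
    using m measurable_levy[OF assms] by (rule integral_distr)
  finally show ?thesis ..
qed

text \<open>Averaging the truncated integral with its reflection replaces the increment by half the
  second difference. The latter is dominated by the integrable weight, so the principal value
  becomes an absolutely convergent integral.\<close>

lemma levy_operator_eq:
  assumes "test_function \<psi>"
  shows "levy_operator \<mu> \<psi> x = (LINT z|\<mu>. second_diff \<psi> x z) / 2"
proof -
  note [measurable] = test_function_imp(2)[OF assms]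
  obtain K where K: "K \<ge> 0" "\<And>x. \<bar>\<psi> x\<bar> \<le> K" using test_function_imp(4)[OF assms] by blast
  obtain C where C: "C \<ge> 0" "\<And>z. \<bar>second_diff \<psi> x z\<bar> \<le> C * min ((norm z)\<^sup>2) 1"
    using test_function_second_diff_bound[OF assms] by metis
  have [measurable]: "{z. norm z > r} \<in> sets borel" for r :: real
    by (intro borel_open open_Collect_less continuous_intros)
  have trunc: "(LINT z:{z. norm z > r}|\<mu>. \<psi> (x + z) - \<psi> x)
      = (LINT z|\<mu>. indicator {z. norm z > r} z * second_diff \<psi> x z) / 2" if r: "r > 0" for r
  proof -
    define f where "f z = indicator {z. norm z > r} z * (\<psi> (x + z) - \<psi> x)" for z
    have f_meas [measurable]: "f \<in> borel_measurable borel" unfolding f_def by measurable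
    have A: "{z. norm z > r} \<in> sets \<mu>" using r by (intro in_sets_levy) auto
    have bound: "integrable \<mu> (\<lambda>z. 2 * K * indicator {z. norm z > r} z)"
      using A emeasure_levy_away[OF r]
      by (intro integrable_mult_right integrable_real_indicator) auto
    have le: "\<bar>f z\<bar> \<le> 2 * K * indicator {z. norm z > r} z" for z
      using K(2)[of "x + z"] K(2)[of x] by (auto simp: f_def indicator_def)
    have int: "integrable \<mu> g"
      if "g \<in> borel_measurable borel" "\<And>z. \<bar>g z\<bar> \<le> 2 * K * indicator {z. norm z > r} z" for g
      by (rule Bochner_Integration.integrable_bound[OF bound])
         (use that in \<open>auto intro!: measurable_levy intro: order_trans[OF _ abs_ge_self]\<close>)
    have "integrable \<mu> f" using f_meas le by (rule int)
    moreover have "integrable \<mu> (\<lambda>z. f (- z))"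
    proof (rule int)
      show "\<bar>f (- z)\<bar> \<le> 2 * K * indicator {z. norm z > r} z" for z
        using le[of "- z"] by (simp add: indicator_def)
    qed measurable
    ultimately have "(LINT z|\<mu>. f z + f (- z)) = 2 * (LINT z|\<mu>. f z)"
      using integral_reflect_levy[OF f_meas] by simp
    moreover have "f z + f (- z) = indicator {z. norm z > r} z * second_diff \<psi> x z" for z
      by (simp add: f_def second_diff_def indicator_def)
    ultimately show ?thesis
      by (simp add: set_lebesgue_integral_def f_def)
  qed
  \<comment> \<open>The truncation radius is written as \<open>inverse t\<close>, so that dominated
    convergence along \<open>at_top\<close> applies; the limit is carried back to
    \<open>at_right 0\<close> afterwards.\<close>
  have "((\<lambda>t. LINT z|\<mu>. indicator {z. norm z > inverse t} z * second_diff \<psi> x z)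
      \<longlongrightarrow> (LINT z|\<mu>. second_diff \<psi> x z)) at_top"
  proof (rule integral_dominated_convergence_at_top)
    show "integrable \<mu> (\<lambda>z. C * min ((norm z)\<^sup>2) 1)"
      by (intro integrable_mult_right integrable_levy_weight)
    show "\<forall>\<^sub>F t in at_top. AE z in \<mu>. norm (indicator {z. norm z > inverse t} z * second_diff \<psi> x z)
        \<le> C * min ((norm z)\<^sup>2) 1"
      using C by (intro always_eventually allI AE_I2) (auto simp: indicator_def)
    show "AE z in \<mu>. ((\<lambda>t. indicator {z. norm z > inverse t} z * second_diff \<psi> x z)
        \<longlongrightarrow> second_diff \<psi> x z) at_top"
    proof (rule AE_I2)
      fix z assume "z \<in> space \<mu>"
      \<comment> \<open>The origin lies outside the space, so every \<open>z\<close> eventually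
        exceeds the truncation radius.\<close>
      then have z: "norm z > 0" by (simp add: space_levy)
      have "\<forall>\<^sub>F t::real in at_top. inverse t < norm z"
        using tendsto_inverse_0_at_top[OF filterlim_ident] z by (rule order_tendstoD(2))
      then have "\<forall>\<^sub>F t in at_top. indicator {z. norm z > inverse t} z * second_diff \<psi> x z = second_diff \<psi> x z"
        by eventually_elim simp
      then show "((\<lambda>t. indicator {z. norm z > inverse t} z * second_diff \<psi> x z)
        \<longlongrightarrow> second_diff \<psi> x z) at_top"
        by (rule tendsto_eventually)
    qed
  qed (auto intro!: measurable_levy)
  then have "((\<lambda>r. (LINT z|\<mu>. indicator {z. norm z > r} z * second_diff \<psi> x z) / 2)
      \<longlongrightarrow> (LINT z|\<mu>. second_diff \<psi> x z) / 2) (at_right 0)"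
    by (intro tendsto_intros) (simp_all add: filterlim_at_right_to_top)
  then have "((\<lambda>r. LINT z:{z. norm z > r}|\<mu>. \<psi> (x + z) - \<psi> x)
      \<longlongrightarrow> (LINT z|\<mu>. second_diff \<psi> x z) / 2) (at_right 0)"
    by (rule Lim_transform_eventually)
       (auto simp: trunc eventually_at_right_less intro: eventually_mono[OF eventually_at_right_less])
  then show ?thesis
    unfolding levy_operator_def by (rule tendsto_Lim[OF trivial_limit_at_right_real])
qed

text \<open>The complement of the support is covered by null balls, possibly uncountably many;
  Lindelof's theorem extracts a countable subcover.\<close>

lemma AE_in_measure_supp: "AE z in \<mu>. z \<in> measure_supp \<mu>"
proof -
  define F where "F = {ball z r |z r. r > 0 \<and> emeasure \<mu> (ball z r - {0}) = 0}"
  obtain F' where F': "F' \<subseteq> F" "countable F'" "\<Union>F' = \<Union>F"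
    using Lindelof[of F] by (auto simp: F_def)
  have "(\<Union>S\<in>F'. S - {0}) \<in> null_sets \<mu>"
    using F'(1,2) by (intro null_sets_UN') (auto simp: F_def null_sets_def intro!: in_sets_levy)
  moreover have "{z \<in> space \<mu>. z \<notin> measure_supp \<mu>} \<subseteq> (\<Union>S\<in>F'. S - {0})"
  proof
    fix z assume "z \<in> {z \<in> space \<mu>. z \<notin> measure_supp \<mu>}"
    then obtain r where z: "z \<noteq> 0" "r > 0" "emeasure \<mu> (ball z r - {0}) = 0"
      by (auto simp: measure_supp_def space_levy)
    then have "z \<in> \<Union>F" by (auto simp: F_def intro!: exI[of _ "ball z r"])
    then show "z \<in> (\<Union>S\<in>F'. S - {0})" using F'(3) z by auto
  qed
  ultimately show ?thesis by (rule AE_I')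
qed

text \<open>
  If the conclusion fails at \<open>x\<close>, the second difference is at most \<open>- \<eta> / 4\<close> on a ball
  around \<open>s\<close> of positive measure, while everywhere it is at most the minimum of
  \<open>2 * \<epsilon>\<close> and the \<mu>-integrable bound, whose integral vanishes as
  \<open>\<epsilon>\<close> tends to 0; so its integral is negative.
\<close>

lemma near_maximum_propagates:
  assumes W: "uniformly_continuous_on UNIV W" and M: "\<And>x. W x \<le> M"
    and C: "\<And>x z. \<bar>second_diff W x z\<bar> \<le> C * min ((norm z)\<^sup>2) 1"
    and harm: "\<And>x. (LINT z|\<mu>. second_diff W x z) = 0"
    and s: "s \<in> measure_supp \<mu>" and \<eta>: "\<eta> > 0"
  shows "\<exists>\<epsilon>>0. \<forall>x. W x > M - \<epsilon> \<longrightarrow> W (x + s) > M - \<eta>"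
proof -
  obtain d where d: "d > 0" "\<And>x y. dist x y < d \<Longrightarrow> dist (W x) (W y) < \<eta> / 2"
    using W \<eta> unfolding uniformly_continuous_on_def
    by (metis UNIV_I half_gt_zero)
  have [measurable]: "W \<in> borel_measurable borel"
    using uniformly_continuous_imp_continuous[OF W] by (rule borel_measurable_continuous_onI)
  have s0: "s \<noteq> 0" and pos: "\<And>r. r > 0 \<Longrightarrow> emeasure \<mu> (ball s r - {0}) > 0"
    using s by (auto simp: measure_supp_def)
  \<comment> \<open>Radius at most \<open>d\<close> brings \<open>W (x + z)\<close> within
    \<open>\<eta> / 2\<close> of \<open>W (x + s)\<close>; radius at most \<open>norm s / 2\<close>
    keeps \<open>B\<close> away from the origin, so its measure is finite.\<close>
  define B where "B = ball s (min d (norm s / 2)) - {0}"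
  have B: "B \<in> sets \<mu>" unfolding B_def by (intro in_sets_levy) auto
  have "B \<subseteq> {z. norm z > norm s / 2}"
  proof
    fix z assume "z \<in> B"
    then have "norm (s - z) < norm s / 2" by (auto simp: B_def dist_norm)
    then show "z \<in> {z. norm z > norm s / 2}" using norm_triangle_sub[of s z] by simp
  qed
  then have "emeasure \<mu> B \<le> emeasure \<mu> {z. norm z > norm s / 2}"
    using s0 by (intro emeasure_mono in_sets_levy borel_open open_Collect_less continuous_intros) auto
  then have Bfin: "emeasure \<mu> B < \<infinity>"
    using emeasure_levy_away[of "norm s / 2"] s0 by (auto intro: le_less_trans)
  define m where "m = measure \<mu> B"
  have m: "m > 0"
    using pos[of "min d (norm s / 2)"] d(1) s0 Bfin
    by (auto simp: m_def B_def[symmetric] measure_def enn2real_positive_iff)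
  have "0 \<le> C * min ((norm s)\<^sup>2) 1" using C[of 0 s] abs_ge_zero order_trans by blast
  then have C0: "C \<ge> 0" using s0 by (simp add: zero_le_mult_iff min_def split: if_splits)
  define h where "h e z = min (2 * e) (C * min ((norm z)\<^sup>2) 1)" for e :: real and z :: 'a
  have hm [measurable]: "h e \<in> borel_measurable borel" for e unfolding h_def[abs_def] by measurable
  have hb: "\<bar>h e z\<bar> \<le> C * min ((norm z)\<^sup>2) 1" if "e \<ge> 0" for e z
    using that C0 by (auto simp: h_def abs_if)
  have "(\<lambda>n. LINT z|\<mu>. h (1 / real (Suc n)) z) \<longlonglongrightarrow> (LINT z|\<mu>. 0)"
  proof (rule integral_dominated_convergence)
    show "integrable \<mu> (\<lambda>z. C * min ((norm z)\<^sup>2) 1)"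
      by (intro integrable_mult_right integrable_levy_weight)
    show "AE z in \<mu>. (\<lambda>n. h (1 / real (Suc n)) z) \<longlonglongrightarrow> 0"
    proof (rule AE_I2)
      fix z
      have "(\<lambda>n. h (1 / real (Suc n)) z) \<longlonglongrightarrow> min (2 * 0) (C * min ((norm z)\<^sup>2) 1)"
        unfolding h_def using LIMSEQ_inverse_real_of_nat
        by (intro tendsto_intros) (simp add: inverse_eq_divide)
      then show "(\<lambda>n. h (1 / real (Suc n)) z) \<longlonglongrightarrow> 0" using C0 by (simp add: min_def)
    qed
    show "AE z in \<mu>. norm (h (1 / real (Suc n)) z) \<le> C * min ((norm z)\<^sup>2) 1" for n
      using hb by auto
  qed (auto intro!: measurable_levy)
  then have "\<forall>\<^sub>F n in sequentially. (LINT z|\<mu>. h (1 / real (Suc n)) z) < \<eta> / 4 * m"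
    using m \<eta> by (intro order_tendstoD(2)) auto
  \<comment> \<open>On \<open>B\<close> the second difference is below
    \<open>(M - \<eta> / 2) + M - 2 * (M - \<epsilon>)\<close>, that is
    \<open>2 * \<epsilon> - \<eta> / 2\<close>; with \<epsilon> below \<open>\<eta> / 8\<close> this
    is less than \<open>- \<eta> / 4\<close>.\<close>
  moreover have "\<forall>\<^sub>F n in sequentially. 1 / real (Suc n) < \<eta> / 8"
    using LIMSEQ_inverse_real_of_nat \<eta> by (intro order_tendstoD(2)) (auto simp: inverse_eq_divide)
  ultimately obtain n where n: "(LINT z|\<mu>. h (1 / real (Suc n)) z) < \<eta> / 4 * m" "1 / real (Suc n) < \<eta> / 8"
    using eventually_happens'[OF sequentially_bot eventually_conj] by blast
  define \<epsilon> where "\<epsilon> = 1 / real (Suc n)"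
  have \<epsilon>: "\<epsilon> > 0" "\<epsilon> < \<eta> / 8" "(LINT z|\<mu>. h \<epsilon> z) < \<eta> / 4 * m"
    using n by (auto simp: \<epsilon>_def)
  have "W (x + s) > M - \<eta>" if x: "W x > M - \<epsilon>" for x
  proof (rule ccontr)
    assume neg: "\<not> W (x + s) > M - \<eta>"
    have le: "second_diff W x z \<le> h \<epsilon> z - \<eta> / 4 * indicator B z" for z
    proof (cases "z \<in> B")
      case True
      then have "dist (W (x + z)) (W (x + s)) < \<eta> / 2"
        by (intro d(2)) (auto simp: B_def dist_norm norm_minus_commute)
      then have "W (x + z) < M - \<eta> / 2" using neg unfolding dist_real_def by linarith
      moreover have "h \<epsilon> z \<ge> 0" using \<epsilon>(1) C0 by (simp add: h_def)
      ultimately show ?thesis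
        using True M[of "x - z"] x \<epsilon>(2) by (simp add: second_diff_def)
    next
      case False
      have "second_diff W x z \<le> 2 * \<epsilon>"
        using M[of "x + z"] M[of "x - z"] x by (simp add: second_diff_def)
      then show ?thesis using False C[of x z] by (simp add: h_def)
    qed
    have int1: "integrable \<mu> (second_diff W x)"
      by (rule integrable_of_levy_bound[OF _ C]) measurable
    have int2: "integrable \<mu> (h \<epsilon>)"
      using hb[of \<epsilon>] \<epsilon>(1) by (intro integrable_of_levy_bound) auto
    have int3: "integrable \<mu> (\<lambda>z. \<eta> / 4 * indicator B z)"
      using B Bfin by (intro integrable_mult_right integrable_real_indicator)
    have "(LINT z|\<mu>. second_diff W x z) \<le> (LINT z|\<mu>. h \<epsilon> z - \<eta> / 4 * indicator B z)"
      using le int1 int2 int3 by (intro integral_mono) auto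
    also have "\<dots> = (LINT z|\<mu>. h \<epsilon> z) - (LINT z|\<mu>. \<eta> / 4 * indicator B z)"
      by (rule Bochner_Integration.integral_diff[OF int2 int3])
    also have "(LINT z|\<mu>. \<eta> / 4 * indicator B z) = \<eta> / 4 * m"
      using sets.sets_into_space[OF B] by (simp add: m_def Int_absorb2)
    finally show False using harm[of x] \<epsilon>(3) by simp
  qed
  with \<epsilon>(1) show ?thesis by blast
qed

text \<open>Tolerances are chosen backwards: the one that suffices for \<open>n\<close> points
  starting at \<open>x + s\<close> becomes the target of a single step from \<open>x\<close>.
  Uniformity in \<open>x\<close> makes this iteration possible.\<close>

lemma near_maximum_propagates_multiple:
  assumes W: "uniformly_continuous_on UNIV W" and M: "\<And>x. W x \<le> M"
    and C: "\<And>x z. \<bar>second_diff W x z\<bar> \<le> C * min ((norm z)\<^sup>2) 1"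
    and harm: "\<And>x. (LINT z|\<mu>. second_diff W x z) = 0"
    and s: "s \<in> measure_supp \<mu>" and \<eta>: "\<eta> > 0"
  shows "\<exists>\<epsilon>>0. \<forall>x. W x > M - \<epsilon> \<longrightarrow> (\<forall>j<n. W (x + real j *\<^sub>R s) > M - \<eta>)"
proof (induction n)
  case 0
  then show ?case by (auto intro: exI[of _ 1])
next
  case (Suc n)
  then obtain e1 where e1: "e1 > 0" "\<And>x j. W x > M - e1 \<Longrightarrow> j < n \<Longrightarrow> W (x + real j *\<^sub>R s) > M - \<eta>"
    by blast
  obtain e2 where e2: "e2 > 0" "\<And>x. W x > M - e2 \<Longrightarrow> W (x + s) > M - e1"
    using near_maximum_propagates[OF W M C harm s e1(1)] by blast
  \<comment> \<open>In the minimum, \<eta> handles the starting point \<open>j = 0\<close> and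
    \<open>e2\<close> all later points.\<close>
  have "W (x + real j *\<^sub>R s) > M - \<eta>" if x: "W x > M - min e2 \<eta>" and j: "j < Suc n" for x j
  proof (cases j)
    case 0
    then show ?thesis using x by simp
  next
    case (Suc i)
    then have "W ((x + s) + real i *\<^sub>R s) > M - \<eta>"
      using x j by (intro e1(2) e2(2)) auto
    then show ?thesis using Suc by (simp add: algebra_simps)
  qed
  then show ?case using e2(1) \<eta> by (intro exI[of _ "min e2 \<eta>"]) auto
qed

text \<open>
  If \<open>W x = V (x + s) - V x\<close> had a positive supremum, it would stay near that supremum along
  an arbitrarily long arithmetic progression of step \<open>s\<close>, and the telescoping sum would exceed the
  bound on \<open>V\<close>.
\<close>

lemma harmonic_bounded_le_shift:
  assumes V: "uniformly_continuous_on UNIV V" and K: "\<And>x. \<bar>V x\<bar> \<le> K"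
    and C: "\<And>x z. \<bar>second_diff V x z\<bar> \<le> C * min ((norm z)\<^sup>2) 1"
    and harm: "\<And>x. (LINT z|\<mu>. second_diff V x z) = 0"
    and s: "s \<in> measure_supp \<mu>"
  shows "V (x + s) \<le> V x"
proof (rule ccontr)
  assume "\<not> V (x + s) \<le> V x"
  define W where "W x = V (x + s) - V x" for x
  define M where "M = (SUP x. W x)"
  have "W x \<le> 2 * K" for x using K[of "x + s"] K[of x] by (simp add: W_def)
  then have bdd: "bdd_above (range W)" by (rule bdd_aboveI2)
  have M: "W y \<le> M" for y using cSUP_upper[OF _ bdd] by (simp add: M_def)
  have "M > 0" using M[of x] \<open>\<not> V (x + s) \<le> V x\<close> by (simp add: W_def)
  have uc: "uniformly_continuous_on UNIV (\<lambda>x. V (x + s))"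
    unfolding uniformly_continuous_on_def
  proof (intro allI impI)
    fix e :: real assume "e > 0"
    then obtain d where "d > 0" "\<And>x y. dist x y < d \<Longrightarrow> dist (V x) (V y) < e"
      using V unfolding uniformly_continuous_on_def by blast
    then show "\<exists>d>0. \<forall>x\<in>UNIV. \<forall>y\<in>UNIV. dist y x < d \<longrightarrow> dist (V (y + s)) (V (x + s)) < e"
      by (intro exI[of _ d]) simp
  qed
  have W: "uniformly_continuous_on UNIV W"
    unfolding W_def[abs_def] using uc V by (rule uniformly_continuous_on_diff)
  have [measurable]: "V \<in> borel_measurable borel"
    using uniformly_continuous_imp_continuous[OF V] by (rule borel_measurable_continuous_onI)
  \<comment> \<open>\<open>W\<close> is a difference of translates of \<open>V\<close>, so it
    inherits harmonicity, and the second-difference bound with doubled constant.\<close>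
  have sdW: "second_diff W x z = second_diff V (x + s) z - second_diff V x z" for x z
    by (simp add: W_def second_diff_def algebra_simps)
  have CW: "\<bar>second_diff W x z\<bar> \<le> (2 * C) * min ((norm z)\<^sup>2) 1" for x z
    using C[of "x + s" z] C[of x z] unfolding sdW by (simp add: mult.assoc)
  have int: "integrable \<mu> (second_diff V x)" for x
    by (rule integrable_of_levy_bound[OF _ C]) measurable
  have harmW: "(LINT z|\<mu>. second_diff W x z) = 0" for x
    unfolding sdW using int harm by simp
  \<comment> \<open>With tolerance \<open>M / 2\<close>, each of \<open>n\<close> consecutive
    increments exceeds \<open>M / 2\<close>, whereas \<open>V\<close> oscillates by at most
    \<open>2 * K\<close>.\<close>
  obtain n where n: "real n * (M / 2) > 2 * K"
    using reals_Archimedean3[of "M / 2"] \<open>M > 0\<close> by (metis half_gt_zero)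
  obtain \<epsilon> where \<epsilon>: "\<epsilon> > 0" "\<And>x j. W x > M - \<epsilon> \<Longrightarrow> j < n \<Longrightarrow> W (x + real j *\<^sub>R s) > M - M / 2"
    using near_maximum_propagates_multiple[OF W M CW harmW s, of "M / 2" n] \<open>M > 0\<close> by auto
  obtain y where y: "W y > M - \<epsilon>"
    using less_cSUP_iff[OF _ bdd, of "M - \<epsilon>"] \<epsilon>(1) by (auto simp: M_def)
  have "real n * (M / 2) = (\<Sum>j<n. M / 2)" by simp
  also have "\<dots> \<le> (\<Sum>j<n. W (y + real j *\<^sub>R s))"
    using \<epsilon>(2)[OF y] by (intro sum_mono) force
  also have "\<dots> = (\<Sum>j<n. V (y + real (Suc j) *\<^sub>R s) - V (y + real j *\<^sub>R s))"
    by (simp add: W_def algebra_simps)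
  also have "\<dots> = V (y + real n *\<^sub>R s) - V y"
    by (subst sum_lessThan_telescope) simp
  also have "\<dots> \<le> 2 * K" using K[of "y + real n *\<^sub>R s"] K[of y] by simp
  finally show False using n by simp
qed

text \<open>All hypotheses survive negation, so the one-sided estimate holds for \<open>V\<close>
  and for its negative.\<close>

lemma harmonic_bounded_periodic:
  assumes V: "uniformly_continuous_on UNIV V" and K: "\<And>x. \<bar>V x\<bar> \<le> K"
    and C: "\<And>x z. \<bar>second_diff V x z\<bar> \<le> C * min ((norm z)\<^sup>2) 1"
    and harm: "\<And>x. (LINT z|\<mu>. second_diff V x z) = 0"
    and s: "s \<in> measure_supp \<mu>"
  shows "V (x + s) = V x"
proof (rule antisym)
  show "V (x + s) \<le> V x" by (rule harmonic_bounded_le_shift[OF assms])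
  have sd: "second_diff (\<lambda>x. - V x) x z = - second_diff V x z" for x z
    by (simp add: second_diff_def)
  have "- V (x + s) \<le> - V x"
    by (rule harmonic_bounded_le_shift[of "\<lambda>x. - V x" K C s])
       (use K C harm s uniformly_continuous_on_minus[OF V] in \<open>auto simp: sd\<close>)
  then show "V x \<le> V (x + s)" by simp
qed

end

section \<open>Duality with test functions\<close>

text \<open>The function \<open>V\<close> of the overview: the convolution of \<open>v\<close> with
  the reflection of \<psi>.\<close>

definition correlation :: "('a::euclidean_space \<Rightarrow> real) \<Rightarrow> ('a \<Rightarrow> real) \<Rightarrow> 'a \<Rightarrow> real" where
  "correlation v \<psi> y = (LINT x|lborel. v (x + y) * \<psi> x)"

context
  fixes v \<psi> :: "'a::euclidean_space \<Rightarrow> real" and K :: real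
  assumes v [measurable]: "v \<in> borel_measurable borel" and K: "\<And>x. \<bar>v x\<bar> \<le> K"
    and \<psi>: "test_function \<psi>"
begin

lemma bound_nonneg: "K \<ge> 0"
  using K[of 0] by linarith

text \<open>Hoelder's inequality between bounded and integrable functions. The factor
  \<open>w\<close> is separate from \<open>v\<close> because translates of \<open>v\<close> and its
  absolute value also occur.\<close>

lemma integrable_bounded_mult:
  fixes w g :: "'a \<Rightarrow> real"
  assumes "w \<in> borel_measurable borel" "\<And>x. \<bar>w x\<bar> \<le> K" "integrable lborel g"
  shows "integrable lborel (\<lambda>x. w x * g x)"
    and "\<bar>LINT x|lborel. w x * g x\<bar> \<le> K * (LINT x|lborel. \<bar>g x\<bar>)"
proof -
  have le: "\<bar>w x * g x\<bar> \<le> K * \<bar>g x\<bar>" for x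
    using assms(2)[of x] by (simp add: abs_mult mult_right_mono)
  show int: "integrable lborel (\<lambda>x. w x * g x)"
    by (rule Bochner_Integration.integrable_bound[of _ "\<lambda>x. K * \<bar>g x\<bar>"])
       (use assms le in \<open>auto intro: order_trans[OF _ abs_ge_self]\<close>)
  have "\<bar>LINT x|lborel. w x * g x\<bar> \<le> (LINT x|lborel. \<bar>w x * g x\<bar>)" by (rule integral_abs_bound)
  also have "\<dots> \<le> (LINT x|lborel. K * \<bar>g x\<bar>)"
    using le int assms(3) by (intro integral_mono) auto
  finally show "\<bar>LINT x|lborel. w x * g x\<bar> \<le> K * (LINT x|lborel. \<bar>g x\<bar>)" by simp
qed

lemma integrable_test_shift: "integrable lborel (\<lambda>x. \<psi> (x + a))"
  using lborel_integrable_shift test_function_imp(3)[OF \<psi>] by blast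

text \<open>Moves the translation from the merely measurable \<open>v\<close> to the smooth \<psi>,
  the source of all regularity in \<open>y\<close>.\<close>

lemma correlation_eq: "correlation v \<psi> y = (LINT x|lborel. v x * \<psi> (x - y))"
proof -
  note [measurable] = test_function_imp(2)[OF \<psi>]
  show ?thesis
    using lborel_integral_shift[of "\<lambda>x. v x * \<psi> (x - y)" y] by (simp add: correlation_def)
qed

lemma correlation_bounded: "\<bar>correlation v \<psi> y\<bar> \<le> K * (LINT x|lborel. \<bar>\<psi> x\<bar>)"
  unfolding correlation_def
  by (rule integrable_bounded_mult(2)) (use K test_function_imp(3)[OF \<psi>] in auto)

text \<open>Lets statements at the point 0, known for all test functions, be read at every
  point.\<close>

lemma correlation_shift: "correlation v (\<lambda>x. \<psi> (x + a)) y = correlation v \<psi> (y - a)"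
proof -
  note [measurable] = test_function_imp(2)[OF \<psi>]
  have "correlation v (\<lambda>x. \<psi> (x + a)) y = (LINT x|lborel. v ((x + a) + (y - a)) * \<psi> (x + a))"
    by (simp add: correlation_def algebra_simps)
  also have "\<dots> = correlation v \<psi> (y - a)"
    unfolding correlation_def by (rule lborel_integral_shift) measurable
  finally show ?thesis .
qed

lemma second_diff_correlation:
  "second_diff (correlation v \<psi>) 0 z = (LINT x|lborel. v x * second_diff \<psi> x z)"
proof -
  have int: "integrable lborel (\<lambda>x. v x * \<psi> (x + a))" for a
    using integrable_bounded_mult(1)[OF v K integrable_test_shift] .
  have "(LINT x|lborel. v x * second_diff \<psi> x z)
      = (LINT x|lborel. v x * \<psi> (x + z) + v x * \<psi> (x + - z) - 2 * (v x * \<psi> (x + 0)))"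
    by (intro Bochner_Integration.integral_cong) (auto simp: second_diff_def algebra_simps)
  also have "\<dots> = (LINT x|lborel. v x * \<psi> (x + z)) + (LINT x|lborel. v x * \<psi> (x + - z))
      - 2 * (LINT x|lborel. v x * \<psi> (x + 0))"
    by (simp only: int Bochner_Integration.integral_add Bochner_Integration.integral_diff
        Bochner_Integration.integrable_add integrable_mult_right integral_mult_right_zero)
  finally show ?thesis
    by (simp add: second_diff_def correlation_eq)
qed

text \<open>Translation is continuous in the integral norm on test functions; \<open>K\<close> times
  that modulus bounds the increments. Dividing by \<open>K + 1\<close> covers the case
  \<open>K = 0\<close>.\<close>

lemma uniformly_continuous_correlation: "uniformly_continuous_on UNIV (correlation v \<psi>)"
  unfolding uniformly_continuous_on_def
proof (intro allI impI)
  fix e :: real assume e: "e > 0"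
  obtain d where d: "d > 0" "\<And>z. norm z < d \<Longrightarrow> (LINT x|lborel. \<bar>\<psi> (x + z) - \<psi> x\<bar>) < e / (K + 1)"
    using test_function_L1_modulus[OF \<psi>, of "e / (K + 1)"] e bound_nonneg by auto
  have "dist (correlation v \<psi> y') (correlation v \<psi> y) < e" if "dist y' y < d" for y y'
  proof -
    \<comment> \<open>Translating \<open>g\<close> by \<open>- y\<close> gives the difference of the
      two translates of \<psi>, and its absolute integral depends only on
      \<open>y - y'\<close>.\<close>
    define g where "g x = \<psi> (x + (y - y')) - \<psi> x" for x
    have intg: "integrable lborel g"
      unfolding g_def using integrable_test_shift test_function_imp(3)[OF \<psi>] by auto
    have int: "integrable lborel (\<lambda>x. v x * \<psi> (x + a))" for a
      using integrable_bounded_mult(1)[OF v K integrable_test_shift] .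
    have "correlation v \<psi> y' - correlation v \<psi> y
        = (LINT x|lborel. v x * \<psi> (x + - y') - v x * \<psi> (x + - y))"
      using int[of "- y'"] int[of "- y"] by (simp add: correlation_eq)
    also have "\<dots> = (LINT x|lborel. v x * g (x + - y))"
      by (intro Bochner_Integration.integral_cong) (auto simp: g_def algebra_simps)
    also have "\<bar>\<dots>\<bar> \<le> K * (LINT x|lborel. \<bar>g (x + - y)\<bar>)"
      by (rule integrable_bounded_mult(2)[OF v K lborel_integrable_shift[OF intg]])
    also have "(LINT x|lborel. \<bar>g (x + - y)\<bar>) = (LINT x|lborel. \<bar>g x\<bar>)"
      using intg by (intro lborel_integral_shift[of "\<lambda>x. \<bar>g x\<bar>"]) auto
    also have "K * \<dots> \<le> (K + 1) * (LINT x|lborel. \<bar>g x\<bar>)"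
      by (intro mult_right_mono) auto
    also have "\<dots> < (K + 1) * (e / (K + 1))"
      using d(2)[of "y - y'"] that bound_nonneg unfolding g_def
      by (intro mult_strict_left_mono) (auto simp: dist_norm norm_minus_commute)
    finally show ?thesis using bound_nonneg by (simp add: dist_real_def)
  qed
  with d(1) show "\<exists>d>0. \<forall>y\<in>UNIV. \<forall>y'\<in>UNIV. dist y' y < d \<longrightarrow>
      dist (correlation v \<psi> y') (correlation v \<psi> y) < e" by blast
qed

end

lemma second_diff_correlation_bound:
  fixes v \<psi> :: "'a::euclidean_space \<Rightarrow> real"
  assumes v [measurable]: "v \<in> borel_measurable borel" and K: "\<And>x. \<bar>v x\<bar> \<le> K"
    and \<psi>: "test_function \<psi>"
  obtains C where "\<And>y z. \<bar>second_diff (correlation v \<psi>) y z\<bar> \<le> C * min ((norm z)\<^sup>2) 1"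
proof -
  obtain C where C: "\<And>z. integrable lborel (\<lambda>x. second_diff \<psi> x z)"
    "\<And>z. (LINT x|lborel. \<bar>second_diff \<psi> x z\<bar>) \<le> C * min ((norm z)\<^sup>2) 1"
    by (rule test_function_second_diff_L1_bound[OF \<psi>]) (rule that)
  have "\<bar>second_diff (correlation v \<psi>) y z\<bar> \<le> (K * C) * min ((norm z)\<^sup>2) 1" for y z
  proof -
    \<comment> \<open>Translating \<open>v\<close> moves the base point to 0 and leaves \<psi>,
      hence \<open>C\<close>, untouched; the bound is thus uniform in \<open>y\<close>.\<close>
    have "second_diff (correlation v \<psi>) y z = second_diff (correlation (\<lambda>x. v (x + y)) \<psi>) 0 z"
      by (simp add: second_diff_def correlation_def algebra_simps)
    also have "\<dots> = (LINT x|lborel. v (x + y) * second_diff \<psi> x z)"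
      by (rule second_diff_correlation[OF _ _ \<psi>]) (use K in \<open>auto\<close>)
    also have "\<bar>\<dots>\<bar> \<le> K * (LINT x|lborel. \<bar>second_diff \<psi> x z\<bar>)"
      by (rule integrable_bounded_mult(2)[OF v K \<psi>]) (use K C in auto)
    also have "\<dots> \<le> K * (C * min ((norm z)\<^sup>2) 1)"
      by (intro mult_left_mono C bound_nonneg[OF v K \<psi>])
    finally show ?thesis by (simp add: mult.assoc)
  qed
  then show thesis by (rule that)
qed

text \<open>Fubini's theorem: the absolute integral in \<open>x\<close> of the second difference is
  dominated by the integrable weight in \<open>z\<close>. The measurability claim later allows
  \<open>u\<close> to be replaced by \<open>v\<close> under the integral.\<close>

lemma (in levy_measure) integral_levy_operator:
  assumes v [measurable]: "v \<in> borel_measurable borel" and K: "\<And>x. \<bar>v x\<bar> \<le> K"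
    and \<psi>: "test_function \<psi>"
  shows "levy_operator \<mu> \<psi> \<in> borel_measurable borel"
    and "(LINT x|lborel. v x * levy_operator \<mu> \<psi> x) = (LINT z|\<mu>. second_diff (correlation v \<psi>) 0 z) / 2"
proof -
  interpret sigma_finite_measure \<mu> by (rule sigma_finite_levy)
  interpret pair_sigma_finite \<mu> lborel ..
  note [measurable] = test_function_imp(2)[OF \<psi>]
  obtain C where C: "\<And>z. integrable lborel (\<lambda>x. second_diff \<psi> x z)"
    "\<And>z. (LINT x|lborel. \<bar>second_diff \<psi> x z\<bar>) \<le> C * min ((norm z)\<^sup>2) 1"
    by (rule test_function_second_diff_L1_bound[OF \<psi>]) (rule that)
  \<comment> \<open>The factor \<mu> carries only the trace sigma-algebra, so its projections must
    be supplied as maps into \<open>borel\<close>.\<close>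
  have fst_meas [measurable]: "fst \<in> \<mu> \<Otimes>\<^sub>M N \<rightarrow>\<^sub>M borel" for N :: "'a measure"
    using measurable_compose[OF measurable_fst measurable_levy[OF measurable_ident]] by simp
  have snd_meas [measurable]: "snd \<in> N \<Otimes>\<^sub>M \<mu> \<rightarrow>\<^sub>M borel" for N :: "'a measure"
    using measurable_compose[OF measurable_snd measurable_levy[OF measurable_ident]] by simp
  have [measurable]: "(\<lambda>(x, z). second_diff \<psi> x z) \<in> borel_measurable (lborel \<Otimes>\<^sub>M \<mu>)"
    unfolding second_diff_def by measurable
  have [measurable]: "(\<lambda>x. LINT z|\<mu>. second_diff \<psi> x z) \<in> borel_measurable lborel"
    by measurable
  then show "levy_operator \<mu> \<psi> \<in> borel_measurable borel"
    unfolding levy_operator_eq[OF \<psi>, abs_def] by simp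
  have meas: "(\<lambda>(z, x). v x * second_diff \<psi> x z) \<in> borel_measurable (\<mu> \<Otimes>\<^sub>M lborel)"
    unfolding second_diff_def by measurable
  have int: "integrable (\<mu> \<Otimes>\<^sub>M lborel) (\<lambda>(z, x). v x * second_diff \<psi> x z)"
  proof (rule Fubini_integrable[OF meas])
    have le: "(LINT x|lborel. \<bar>v x * second_diff \<psi> x z\<bar>) \<le> (K * C) * min ((norm z)\<^sup>2) 1" for z
    proof -
      have "(LINT x|lborel. \<bar>v x * second_diff \<psi> x z\<bar>) = \<bar>LINT x|lborel. \<bar>v x\<bar> * \<bar>second_diff \<psi> x z\<bar>\<bar>"
        by (simp add: abs_mult)
      also have "\<dots> \<le> K * (LINT x|lborel. \<bar>\<bar>second_diff \<psi> x z\<bar>\<bar>)"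
        by (rule integrable_bounded_mult(2)[OF v K \<psi>]) (use K C in auto)
      also have "\<dots> \<le> K * (C * min ((norm z)\<^sup>2) 1)"
        using C(2)[of z] bound_nonneg[OF v K \<psi>] by (simp add: mult_left_mono)
      finally show ?thesis by (simp add: mult.assoc)
    qed
    have "(\<lambda>z. LINT x|lborel. \<bar>v x * second_diff \<psi> x z\<bar>) \<in> borel_measurable borel"
      unfolding second_diff_def by measurable
    then show "integrable \<mu> (\<lambda>z. LINT x|lborel. norm (case (z, x) of (z, x) \<Rightarrow> v x * second_diff \<psi> x z))"
      using le by (intro integrable_of_levy_bound[where C = "K * C"]) auto
    show "AE z in \<mu>. integrable lborel (\<lambda>x. case (z, x) of (z, x) \<Rightarrow> v x * second_diff \<psi> x z)"
      using integrable_bounded_mult(1)[OF v K \<psi> v K C(1)] by simp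
  qed
  have "(LINT x|lborel. v x * levy_operator \<mu> \<psi> x)
      = (LINT x|lborel. (LINT z|\<mu>. v x * second_diff \<psi> x z)) / 2"
    by (simp add: levy_operator_eq[OF \<psi>])
  also have "\<dots> = (LINT z|\<mu>. (LINT x|lborel. v x * second_diff \<psi> x z)) / 2"
    using Fubini_integral[OF int] by simp
  finally show "(LINT x|lborel. v x * levy_operator \<mu> \<psi> x) = (LINT z|\<mu>. second_diff (correlation v \<psi>) 0 z) / 2"
    by (simp add: second_diff_correlation[OF v K \<psi>])
qed

text \<open>The group part needs periodicity at every base point, since differences move it; the
  closure part uses continuity at one fixed \<open>x\<close>.\<close>

lemma period_closure_group_closure:
  fixes V :: "'a::euclidean_space \<Rightarrow> real"
  assumes "continuous_on UNIV V" and "\<And>s x. s \<in> S \<Longrightarrow> V (x + s) = V x"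
    and "s \<in> closure (group_closure S)"
  shows "V (x + s) = V x"
proof -
  have grp: "V (y + t) = V y" if "t \<in> group_closure S" for t y
    using that
  proof (induction arbitrary: y)
    case (base t)
    then show ?case using assms(2) by auto
  next
    case (diff t t')
    \<comment> \<open>Both induction hypotheses are applied at the base point \<open>y - t'\<close>,
      where the two shifted values agree with \<open>V (y - t')\<close>.\<close>
    have "V (y + (t - t')) = V ((y - t') + t)" by (simp add: algebra_simps)
    also have "\<dots> = V ((y - t') + t')" using diff.IH by (simp only:)
    finally show ?case by simp
  qed
  have "closed {t. V (x + t) = V x}"
    by (intro closed_Collect_eq continuous_on_compose2[OF assms(1)] continuous_intros) auto
  then show ?thesis
    using closure_minimal[of "group_closure S" "{t. V (x + t) = V x}"] grp assms(3) by blast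
qed

text \<open>Forwards, translated test functions make the second differences integrate to zero at
  every point, so the maximum principle applies. Backwards, the point 0 suffices, since the group
  contains both \<open>z\<close> and \<open>- z\<close>.\<close>

lemma (in levy_measure) harmonic_iff_periodic_correlation:
  assumes v: "v \<in> borel_measurable borel" and K: "\<And>x. \<bar>v x\<bar> \<le> K"
  shows "(\<forall>\<psi>. test_function \<psi> \<longrightarrow> (LINT x|lborel. v x * levy_operator \<mu> \<psi> x) = 0) \<longleftrightarrow>
    (\<forall>s\<in>closure (group_closure (measure_supp \<mu>)). \<forall>\<psi>. test_function \<psi> \<longrightarrow>
      correlation v \<psi> s = correlation v \<psi> 0)" (is "?L \<longleftrightarrow> ?R")
proof
  assume L: ?L
  show ?R
  proof (intro ballI allI impI)
    fix s and \<psi> :: "'a \<Rightarrow> real" assume s: "s \<in> closure (group_closure (measure_supp \<mu>))" and \<psi>: "test_function \<psi>"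
    note uc = uniformly_continuous_correlation[OF v K \<psi>]
    obtain C where C: "\<And>y z. \<bar>second_diff (correlation v \<psi>) y z\<bar> \<le> C * min ((norm z)\<^sup>2) 1"
      using second_diff_correlation_bound[OF v K \<psi>] by blast
    have harm: "(LINT z|\<mu>. second_diff (correlation v \<psi>) y z) = 0" for y
    proof -
      have \<psi>y: "test_function (\<lambda>x. \<psi> (x + - y))" by (rule test_function_shift[OF \<psi>])
      have "second_diff (correlation v \<psi>) y = second_diff (correlation v (\<lambda>x. \<psi> (x + - y))) 0"
        unfolding second_diff_def correlation_shift[OF v K \<psi>] by (simp add: algebra_simps fun_eq_iff)
      then show ?thesis using L \<psi>y integral_levy_operator(2)[OF v K \<psi>y] by simp
    qed
    have "correlation v \<psi> (0 + s) = correlation v \<psi> 0"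
    proof (rule period_closure_group_closure[OF uniformly_continuous_imp_continuous[OF uc] _ s])
      show "correlation v \<psi> (x + t) = correlation v \<psi> x" if "t \<in> measure_supp \<mu>" for x t
        by (rule harmonic_bounded_periodic[OF uc correlation_bounded[OF v K \<psi>] C harm that])
    qed
    then show "correlation v \<psi> s = correlation v \<psi> 0" by simp
  qed
next
  assume R: ?R
  show ?L
  proof (intro allI impI)
    fix \<psi> :: "'a \<Rightarrow> real" assume \<psi>: "test_function \<psi>"
    have "AE z in \<mu>. second_diff (correlation v \<psi>) 0 z = 0"
      using AE_in_measure_supp
    proof eventually_elim
      case (elim z)
      then have "z \<in> group_closure (measure_supp \<mu>)" by (auto intro: group_closure.base)
      then have "z \<in> closure (group_closure (measure_supp \<mu>))"
        "- z \<in> closure (group_closure (measure_supp \<mu>))"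
        using closure_subset group_closure_minus_iff by blast+
      then have "correlation v \<psi> z = correlation v \<psi> 0" "correlation v \<psi> (- z) = correlation v \<psi> 0"
        using R \<psi> by blast+
      then show ?case by (simp add: second_diff_def)
    qed
    then have "(LINT z|\<mu>. second_diff (correlation v \<psi>) 0 z) = 0"
      by (rule integral_eq_zero_AE)
    then show "(LINT x|lborel. v x * levy_operator \<mu> \<psi> x) = 0"
      using integral_levy_operator(2)[OF v K \<psi>] by simp
  qed
qed

section \<open>Borel representatives and the passage from \<open>lebesgue\<close> to
  \<open>lborel\<close>\<close>

lemma L_infinity_borel_representative:
  assumes "L_infinity u"
  obtains v K where "v \<in> borel_measurable borel" "\<And>x. \<bar>v x\<bar> \<le> K" "AE x in lborel. u x = v x"
proof -
  obtain C where u: "u \<in> borel_measurable lebesgue" and C: "AE x in lborel. \<bar>u x\<bar> \<le> C"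
    using assms unfolding L_infinity_def AE_completion_iff by blast
  obtain w where w: "w \<in> borel_measurable lborel" "AE x in lborel. u x = w x"
    using completion_ex_borel_measurable_real[OF u] by blast
  have [measurable]: "w \<in> borel_measurable borel" using w(1) by simp
  show thesis
  \<comment> \<open>Clipping changes \<open>w\<close> only on a null set and makes the bound hold
    everywhere; the absolute value of \<open>C\<close> keeps the clipping interval nonempty without
    a sign argument.\<close>
  proof (rule that[of "\<lambda>x. max (- \<bar>C\<bar>) (min \<bar>C\<bar> (w x))" "\<bar>C\<bar>"])
    show "AE x in lborel. u x = max (- \<bar>C\<bar>) (min \<bar>C\<bar> (w x))"
      using C w(2) by eventually_elim auto
    show "(\<lambda>x. max (- \<bar>C\<bar>) (min \<bar>C\<bar> (w x))) \<in> borel_measurable borel" by measurable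
  qed linarith
qed

lemma AE_lborel_shift:
  assumes "AE x in lborel. P (x::'a::euclidean_space)"
  shows "AE x in lborel. P (x + s)"
proof -
  have "AE x in distr lborel borel ((+) s). P x"
    using assms by (simp only: lborel_distr_plus)
  then have "AE x in lborel. P (s + x)"
    by (rule AE_distrD[rotated]) simp
  then show ?thesis by (simp add: add.commute)
qed

text \<open>Completeness of Lebesgue measure makes \<open>f\<close> measurable, as it agrees almost
  everywhere with a Borel function.\<close>

lemma integral_lebesgue_eq_lborel:
  fixes f :: "'a::euclidean_space \<Rightarrow> real"
  assumes "g \<in> borel_measurable borel" and "AE x in lborel. f x = g x"
  shows "integral\<^sup>L lebesgue f = integral\<^sup>L lborel g"
proof -
  have g: "g \<in> borel_measurable lborel" using assms(1) by simp
  have ae: "AE x in lebesgue. g x = f x"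
    using AE_completion[OF assms(2)] by eventually_elim simp
  have "f \<in> borel_measurable lebesgue"
    using measurable_completion[OF g] ae by (rule borel_measurable_AE)
  then have "integral\<^sup>L lebesgue f = integral\<^sup>L lebesgue g"
    using ae g by (intro integral_cong_AE) (auto intro: measurable_completion)
  also have "\<dots> = integral\<^sup>L lborel g" by (rule integral_completion[OF g])
  finally show ?thesis .
qed

theorem theorem4p11:
  fixes \<mu> :: "'a::euclidean_space measure" and u :: "'a \<Rightarrow> real"
  assumes "radon_measure_punctured \<mu>"
    and "symmetric_measure \<mu>"
    and "(\<integral>\<^sup>+ z. ennreal (min ((norm z)\<^sup>2) 1) \<partial>\<mu>) < \<infinity>"
    and "L_infinity u"
  shows "levy_harmonic_distr \<mu> u \<longleftrightarrow> periodic_ae (closure (group_closure (measure_supp \<mu>))) u"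
proof -
  interpret levy_measure \<mu> by standard (fact assms)+
  obtain v K where v [measurable]: "v \<in> borel_measurable borel" and K: "\<And>x. \<bar>v x\<bar> \<le> K"
    and uv: "AE x in lborel. u x = v x"
    using L_infinity_borel_representative[OF assms(4)] by blast
  have harm: "(LINT x|lebesgue. u x * levy_operator \<mu> \<psi> x) = (LINT x|lborel. v x * levy_operator \<mu> \<psi> x)"
    if \<psi>: "test_function \<psi>" for \<psi>
  proof (rule integral_lebesgue_eq_lborel)
    note [measurable] = integral_levy_operator(1)[OF v K \<psi>]
    show "(\<lambda>x. v x * levy_operator \<mu> \<psi> x) \<in> borel_measurable borel" by measurable
    show "AE x in lborel. u x * levy_operator \<mu> \<psi> x = v x * levy_operator \<mu> \<psi> x"
      using uv by eventually_elim simp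
  qed
  have per: "(LINT x|lebesgue. (u (x + s) - u x) * \<psi> x) = correlation v \<psi> s - correlation v \<psi> 0"
    if \<psi>: "test_function \<psi>" for \<psi> s
  proof -
    note [measurable] = test_function_imp(2)[OF \<psi>]
    have "(LINT x|lebesgue. (u (x + s) - u x) * \<psi> x) = (LINT x|lborel. (v (x + s) - v x) * \<psi> x)"
    proof (rule integral_lebesgue_eq_lborel)
      show "(\<lambda>x. (v (x + s) - v x) * \<psi> x) \<in> borel_measurable borel" by measurable
      show "AE x in lborel. (u (x + s) - u x) * \<psi> x = (v (x + s) - v x) * \<psi> x"
        using uv AE_lborel_shift[OF uv, of s] by eventually_elim simp
    qed
    also have "\<dots> = (LINT x|lborel. v (x + s) * \<psi> x - v (x + 0) * \<psi> x)"
      by (simp add: left_diff_distrib)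
    also have "\<dots> = correlation v \<psi> s - correlation v \<psi> 0"
      unfolding correlation_def
      by (intro Bochner_Integration.integral_diff integrable_bounded_mult(1)[OF v K \<psi>])
         (use K test_function_imp(3)[OF \<psi>] in auto)
    finally show ?thesis .
  qed
  show ?thesis
    unfolding levy_harmonic_distr_def periodic_ae_def
    using harmonic_iff_periodic_correlation[OF v K] by (simp add: harm per)
qed

end
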